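(* (1) Let $v$ be a weighted game and $u$ a linear game on $n$ voters with $W_u=W_v\setminus\{A\}$ for a coalition $A\in W_v$. Then $u$ is weighted if and only if there exists $\mathbf w$ in the footprint $\pi(P_v)$ such that $w_A<w_B$ for every winning coalition $B\neq A$ of $v$. (2) Let $u$ be a weighted game and $v$ a linear game on $n$ voters with $W_u=W_v\setminus\{A\}$ for a coalition $A\in W_v$. Then $v$ is weighted if and only if there exists $\mathbf w$ in the footprint $\pi(P_u)$ such that $w_A>w_C$ for every losing coalition $C\neq A$ of $u$.
   Context: Let $N=\{1,\dots,n\}$. A simple game is a family $W$ of subsets of $N$ (winning coalitions) with $N\in W$, $\emptyset\notin W$, closed under supersets. Order subsets of $N$ by: for $A=\{a_1>\dots>a_k\}$, $B=\{b_1>\dots>b_j\}$, $B\ge A$ iff $k\le j$ and $b_i\ge a_i$ for $i\le k$. A linear game is a simple game whose winning set is an up-set for this order. Let $\Delta_n=\{\mathbf w=(w_n,\dots,w_1): w_n\ge\dots\ge w_1\ge0,\ \sum_i w_i=1\}$ and for a coalition $A$ write $w_A=\sum_{i\in A}w_i$. A linear game $v$ is weighted if there is $(q:\mathbf w)\in(0,1]\times\Delta_n$ with $A\in W_v$ iff $w_A\ge q$ (a realization); $P_v$ is the set of realizations, and the footprint $\pi(P_v)\subseteq\Delta_n$ is the set of $\mathbf w$ for which some $(q:\mathbf w)$ lies in $P_v$. *)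

theory Defs
  imports "HOL-Analysis.Analysis"
begin

text \<open>
  Voters are the numbers \<open>1, \<dots>, n\<close>, and a game on \<open>n\<close> voters is identified with its
  family of winning coalitions.
\<close>

definition simple_game :: "nat \<Rightarrow> nat set set \<Rightarrow> bool" where
  "simple_game n W \<longleftrightarrow>
     W \<subseteq> Pow {1..n} \<and> {1..n} \<in> W \<and> {} \<notin> W \<and>
     (\<forall>A B. A \<in> W \<longrightarrow> A \<subseteq> B \<longrightarrow> B \<subseteq> {1..n} \<longrightarrow> B \<in> W)"

definition desc_list :: "nat set \<Rightarrow> nat list" where
  "desc_list A = rev (sorted_list_of_set A)"

text \<open>
  \<open>coalition_le A B\<close> is \<open>B \<ge> A\<close> in the order on coalitions: the elements are listed in
  decreasing order and compared position by position. Only used for finite sets.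
\<close>

definition coalition_le :: "nat set \<Rightarrow> nat set \<Rightarrow> bool" where
  "coalition_le A B \<longleftrightarrow>
     card A \<le> card B \<and> (\<forall>i < card A. desc_list A ! i \<le> desc_list B ! i)"

definition linear_game :: "nat \<Rightarrow> nat set set \<Rightarrow> bool" where
  "linear_game n W \<longleftrightarrow>
     simple_game n W \<and>
     (\<forall>A B. A \<in> W \<longrightarrow> B \<subseteq> {1..n} \<longrightarrow> coalition_le A B \<longrightarrow> B \<in> W)"

definition losing :: "nat \<Rightarrow> nat set set \<Rightarrow> nat set set" where
  "losing n W = Pow {1..n} - W"

text \<open>
  A vector indexed by \<open>1, \<dots>, n\<close> is a function that is \<open>undefined\<close> outside \<open>{1..n}\<close>, so that
  distinct functions are distinct vectors.
\<close>

definition weight_simplex :: "nat \<Rightarrow> (nat \<Rightarrow> real) set" where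
  "weight_simplex n =
     {w \<in> extensional {1..n}.
        (\<forall>i\<in>{1..n}. 0 \<le> w i) \<and>
        (\<forall>i\<in>{1..n}. \<forall>j\<in>{1..n}. i \<le> j \<longrightarrow> w i \<le> w j) \<and>
        (\<Sum>i\<in>{1..n}. w i) = 1}"

definition coalition_weight :: "(nat \<Rightarrow> real) \<Rightarrow> nat set \<Rightarrow> real" where
  "coalition_weight w A = (\<Sum>i\<in>A. w i)"

definition realizations :: "nat \<Rightarrow> nat set set \<Rightarrow> (real \<times> (nat \<Rightarrow> real)) set" where
  "realizations n W =
     {(q, w). q \<in> {0<..1} \<and> w \<in> weight_simplex n \<and>
        (\<forall>A. A \<subseteq> {1..n} \<longrightarrow> (A \<in> W \<longleftrightarrow> q \<le> coalition_weight w A))}"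

definition weighted_game :: "nat \<Rightarrow> nat set set \<Rightarrow> bool" where
  "weighted_game n W \<longleftrightarrow> linear_game n W \<and> realizations n W \<noteq> {}"

definition footprint :: "nat \<Rightarrow> nat set set \<Rightarrow> (nat \<Rightarrow> real) set" where
  "footprint n W = {w \<in> weight_simplex n. \<exists>q. (q, w) \<in> realizations n W}"

end

theory Submission
  imports Defs
begin

text \<open>
  A weight vector \<open>w\<close> lies in the footprint of a game iff every winning coalition is strictly
  heavier than every losing one. If \<open>U = V - {A}\<close>, and \<open>w\<close>, \<open>x\<close> realize \<open>V\<close>, \<open>U\<close>, then along the
  segment from \<open>w\<close> to \<open>x\<close> every \<open>B \<in> U\<close> stays strictly heavier than every coalition losing
  in \<open>V\<close>. So at each point \<open>A\<close> is lighter than all of the former or heavier than all of the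
  latter. Both conditions are open, the first holds at \<open>x\<close> and the second at \<open>w\<close>; as the segment
  is connected, they hold simultaneously at some point, which lies in both footprints.
\<close>

lemma weight_simplex_convex:
  assumes "w \<in> weight_simplex n" "x \<in> weight_simplex n" "0 \<le> t" "t \<le> 1"
  shows "(\<lambda>i\<in>{1..n}. (1 - t) * w i + t * x i) \<in> weight_simplex n"
  using assms
  by (auto simp: weight_simplex_def sum.distrib simp flip: sum_distrib_left
      intro!: add_mono mult_left_mono)

text \<open>The bound on \<open>A\<close> matters because the restricted function is
  \<open>undefined\<close> outside \<open>{1..n}\<close>; inside it the weight is linear in the
  vector.\<close>

lemma coalition_weight_segment:
  assumes "A \<subseteq> {1..n}"
  shows "coalition_weight (\<lambda>i\<in>{1..n}. (1 - t) * w i + t * x i) A =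
    (1 - t) * coalition_weight w A + t * coalition_weight x A"
proof -
  have "coalition_weight (\<lambda>i\<in>{1..n}. (1 - t) * w i + t * x i) A =
      (\<Sum>i\<in>A. (1 - t) * w i + t * x i)"
    unfolding coalition_weight_def using assms by (intro sum.cong) auto
  then show ?thesis
    by (simp add: coalition_weight_def sum.distrib sum_distrib_left)
qed

lemma simple_game_subset_Pow: "simple_game n W \<Longrightarrow> W \<subseteq> Pow {1..n}"
  by (simp add: simple_game_def)

lemma linear_game_imp_simple_game: "linear_game n W \<Longrightarrow> simple_game n W"
  by (simp add: linear_game_def)

lemma weighted_game_imp_simple_game: "weighted_game n W \<Longrightarrow> simple_game n W"
  by (simp add: weighted_game_def linear_game_imp_simple_game)

text \<open>A quota lies between the weights of losing and winning coalitions; conversely, since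
  there are finitely many coalitions, the smallest winning weight serves as quota. This eliminates
  \<open>q\<close> from the rest of the argument.\<close>

lemma footprint_iff_separates:
  assumes W: "simple_game n W"
  shows "w \<in> footprint n W \<longleftrightarrow>
    w \<in> weight_simplex n \<and>
    (\<forall>B\<in>W. \<forall>C\<in>losing n W. coalition_weight w C < coalition_weight w B)"
proof (intro iffI conjI; (elim conjE)?)
  assume "w \<in> footprint n W"
  then obtain q where q: "\<And>A. A \<subseteq> {1..n} \<Longrightarrow> A \<in> W \<longleftrightarrow> q \<le> coalition_weight w A"
    by (auto simp: footprint_def realizations_def)
  show "\<forall>B\<in>W. \<forall>C\<in>losing n W. coalition_weight w C < coalition_weight w B"
  proof (intro ballI)
    fix B C assume "B \<in> W" "C \<in> losing n W"
    then have "q \<le> coalition_weight w B" "\<not> q \<le> coalition_weight w C"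
      using q simple_game_subset_Pow[OF W] by (auto simp: losing_def)
    then show "coalition_weight w C < coalition_weight w B" by simp
  qed
next
  assume w: "w \<in> weight_simplex n"
    and sep: "\<forall>B\<in>W. \<forall>C\<in>losing n W. coalition_weight w C < coalition_weight w B"
  have fin: "finite W"
    using simple_game_subset_Pow[OF W] by (rule finite_subset) simp
  have full: "{1..n} \<in> W" and empty: "{} \<in> losing n W"
    using W by (auto simp: simple_game_def losing_def)
  define q where "q = Min (coalition_weight w ` W)"
  have "q \<in> coalition_weight w ` W"
    unfolding q_def using fin full by (intro Min_in) auto
  then obtain D where D: "D \<in> W" "q = coalition_weight w D" by blast
  have q_le: "q \<le> coalition_weight w B" if "B \<in> W" for B
    unfolding q_def using fin that by simp
  \<comment> \<open>The empty coalition loses and weighs 0, so the winning coalition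
    \<open>D\<close> weighs more. The upper bound below comes from the grand coalition, which wins
    and weighs 1.\<close>
  have "0 < q"
    using sep D empty by (force simp: coalition_weight_def)
  moreover have "q \<le> 1"
    using q_le[OF full] w by (simp add: coalition_weight_def weight_simplex_def)
  \<comment> \<open>A losing \<open>B\<close> is strictly lighter than \<open>D\<close>, whose
    weight is exactly \<open>q\<close>.\<close>
  moreover have "B \<in> W \<longleftrightarrow> q \<le> coalition_weight w B" if "B \<subseteq> {1..n}" for B
    using q_le[of B] bspec[OF bspec[OF sep D(1)], of B] D(2) that
    by (cases "B \<in> W") (auto simp: losing_def)
  ultimately have "(q, w) \<in> realizations n W"
    using w by (simp add: realizations_def)
  then show "w \<in> footprint n W"
    using w by (auto simp: footprint_def)
qed (simp add: footprint_def)

lemma weighted_game_iff_footprint: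
  "weighted_game n W \<longleftrightarrow> linear_game n W \<and> footprint n W \<noteq> {}"
  by (auto simp: weighted_game_def footprint_def realizations_def)

text \<open>The common core of both parts: placing \<open>A\<close> strictly between the other
  winning coalitions and the losing ones makes \<open>y\<close> realize both games, so each forward
  direction follows.\<close>

lemma ex_weights_strictly_between:
  assumes V: "weighted_game n V" and U: "weighted_game n (V - {A})" and A: "A \<in> V"
  obtains y where "y \<in> weight_simplex n"
    and "\<forall>B\<in>V - {A}. coalition_weight y A < coalition_weight y B"
    and "\<forall>C\<in>losing n V. coalition_weight y C < coalition_weight y A"
proof -
  let ?U = "V - {A}"
  have sV: "simple_game n V" and sU: "simple_game n ?U"
    using V U by (simp_all add: weighted_game_imp_simple_game)
  note V_sub = simple_game_subset_Pow[OF sV]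
  have A_sub: "A \<subseteq> {1..n}" using V_sub A by blast
  obtain w x where w: "w \<in> footprint n V" and x: "x \<in> footprint n ?U"
    using V U by (auto simp: weighted_game_iff_footprint)
  \<comment> \<open>The path is defined for every real \<open>t\<close>, so that the sets
    \<open>P\<close> and \<open>Q\<close> below are open in the whole line; only on
    \<open>{0..1}\<close> does it stay in the simplex.\<close>
  define y where "y t = (\<lambda>i\<in>{1..n}. (1 - t) * w i + t * x i)" for t
  have yS: "y t \<in> weight_simplex n" if "t \<in> {0..1}" for t
    using w x that unfolding y_def
    by (intro weight_simplex_convex) (auto simp: footprint_def)
  have yw: "coalition_weight (y t) B =
      (1 - t) * coalition_weight w B + t * coalition_weight x B" if "B \<subseteq> {1..n}" for t B
    unfolding y_def by (rule coalition_weight_segment[OF that])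
  have wsep: "coalition_weight w C < coalition_weight w B" if "B \<in> V" "C \<in> losing n V" for B C
    using w that by (auto simp: footprint_iff_separates[OF sV])
  have xsep: "coalition_weight x C < coalition_weight x B"
    if "B \<in> ?U" "C \<in> losing n ?U" for B C
    using x that unfolding footprint_iff_separates[OF sU] by blast
  have A_losing: "A \<in> losing n ?U" and losing_sub: "losing n V \<subseteq> losing n ?U"
    using A_sub by (auto simp: losing_def)
  \<comment> \<open>Here \<open>B\<close> wins and \<open>C\<close> loses in both games, so the
    difference of their weights is negative at both endpoints, hence at every convex
    combination.\<close>
  have ysep: "coalition_weight (y t) C < coalition_weight (y t) B"
    if "t \<in> {0..1}" "B \<in> ?U" "C \<in> losing n V" for t B C
  proof -
    have "coalition_weight w C < coalition_weight w B" "coalition_weight x C < coalition_weight x B"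
      using wsep xsep losing_sub that by blast+
    moreover have "B \<subseteq> {1..n}" "C \<subseteq> {1..n}"
      using that V_sub by (auto simp: losing_def)
    ultimately show ?thesis
      using that(1)
        convex_bound_lt[of "coalition_weight w C - coalition_weight w B" 0
          "coalition_weight x C - coalition_weight x B" "1 - t" t]
      by (simp add: yw algebra_simps)
  qed
  \<comment> \<open>For \<open>t\<close> in \<open>{0..1}\<close>, by \<open>ysep\<close>,
    membership in \<open>P\<close> puts \<open>y t\<close> in the footprint of
    \<open>V - {A}\<close>, and membership in \<open>Q\<close> puts it in that of
    \<open>V\<close>.\<close>
  define P where "P = (\<Inter>B\<in>?U. {t. coalition_weight (y t) A < coalition_weight (y t) B})"
  define Q where "Q = (\<Inter>C\<in>losing n V. {t. coalition_weight (y t) C < coalition_weight (y t) A})"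
  have fin: "finite V" "finite (losing n V)"
    using finite_subset[OF V_sub] by (auto simp: losing_def)
  have op: "open {t. coalition_weight (y t) C < coalition_weight (y t) B}"
    if "B \<subseteq> {1..n}" "C \<subseteq> {1..n}" for B C
    unfolding yw[OF that(1)] yw[OF that(2)]
    by (intro open_Collect_less continuous_intros)
  have "open P"
    unfolding P_def using fin V_sub A_sub by (intro open_INT ballI op) auto
  moreover have "open Q"
    unfolding Q_def using fin A_sub by (intro open_INT ballI op) (auto simp: losing_def)
  moreover have "{0..1} \<subseteq> P \<union> Q"
  proof
    fix t :: real assume t: "t \<in> {0..1}"
    show "t \<in> P \<union> Q"
    proof (cases "t \<in> P")
      case False
      \<comment> \<open>Outside \<open>P\<close>, some \<open>B\<close> is no heavier than
        \<open>A\<close>; since \<open>B\<close> outweighs every coalition losing in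
        \<open>V\<close>, so does \<open>A\<close>.\<close>
      then obtain B where "B \<in> ?U" "coalition_weight (y t) B \<le> coalition_weight (y t) A"
        by (auto simp: P_def not_less)
      then have "t \<in> Q"
        using ysep[OF t] by (force simp: Q_def)
      then show ?thesis by blast
    qed simp
  qed
  \<comment> \<open>At \<open>t = 1\<close> the weights are those of \<open>x\<close>, for which
    \<open>A\<close> is losing; at \<open>t = 0\<close> they are those of \<open>w\<close>, for
    which \<open>A\<close> is winning.\<close>
  moreover have "1 \<in> P"
    using xsep[OF _ A_losing] A_sub by (simp add: P_def yw subsetD[OF V_sub, simplified])
  moreover have "0 \<in> Q"
    using wsep[OF A] A_sub by (auto simp: Q_def yw losing_def)
  moreover have "(0::real) \<in> {0..1}" "(1::real) \<in> {0..1}" by simp_all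
  ultimately have "P \<inter> Q \<inter> {0..1} \<noteq> {}"
    using connectedD[OF connected_Icc[of 0 "1::real"], of P Q] by blast
  then obtain t where "t \<in> {0..1}" "t \<in> P" "t \<in> Q" by blast
  then show ?thesis
    using that[of "y t"] yS by (auto simp: P_def Q_def)
qed

lemma losing_remove:
  assumes "A \<in> V" "V \<subseteq> Pow {1..n}"
  shows "losing n (V - {A}) = insert A (losing n V)"
  using assms by (auto simp: losing_def)

lemma weighted_remove_iff:
  assumes V: "weighted_game n V" and U: "linear_game n (V - {A})" and A: "A \<in> V"
  shows "weighted_game n (V - {A}) \<longleftrightarrow>
    (\<exists>w\<in>footprint n V. \<forall>B\<in>V. B \<noteq> A \<longrightarrow> coalition_weight w A < coalition_weight w B)"
    (is "_ \<longleftrightarrow> ?R")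
proof
  have sV: "simple_game n V" and sU: "simple_game n (V - {A})"
    using V U by (simp_all add: weighted_game_imp_simple_game linear_game_imp_simple_game)
  note losing = losing_remove[OF A simple_game_subset_Pow[OF sV]]
  show ?R if wU: "weighted_game n (V - {A})"
  proof -
    obtain y where y: "y \<in> weight_simplex n"
      "\<forall>B\<in>V - {A}. coalition_weight y A < coalition_weight y B"
      "\<forall>C\<in>losing n V. coalition_weight y C < coalition_weight y A"
      using ex_weights_strictly_between[OF V wU A] .
    then have "y \<in> footprint n V"
      unfolding footprint_iff_separates[OF sV] by (metis Diff_iff order.strict_trans singletonD)
    with y show ?thesis by blast
  qed
  assume ?R
  then obtain w where "w \<in> footprint n V"
    "\<forall>B\<in>V. B \<noteq> A \<longrightarrow> coalition_weight w A < coalition_weight w B" by blast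
  \<comment> \<open>Passing to \<open>V - {A}\<close> adds only \<open>A\<close> to the losing
    coalitions, and the new comparisons are exactly those that \<open>?R\<close> supplies.\<close>
  then have "w \<in> footprint n (V - {A})"
    unfolding footprint_iff_separates[OF sV] footprint_iff_separates[OF sU] losing by auto
  with U show "weighted_game n (V - {A})"
    by (auto simp: weighted_game_iff_footprint)
qed

lemma weighted_insert_iff:
  assumes U: "weighted_game n (V - {A})" and V: "linear_game n V" and A: "A \<in> V"
  shows "weighted_game n V \<longleftrightarrow>
    (\<exists>w\<in>footprint n (V - {A}). \<forall>C\<in>losing n (V - {A}). C \<noteq> A \<longrightarrow>
      coalition_weight w A > coalition_weight w C)"
    (is "_ \<longleftrightarrow> ?R")
proof
  have sV: "simple_game n V" and sU: "simple_game n (V - {A})"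
    using V U by (simp_all add: weighted_game_imp_simple_game linear_game_imp_simple_game)
  note losing = losing_remove[OF A simple_game_subset_Pow[OF sV]]
  show ?R if wV: "weighted_game n V"
  proof -
    obtain y where y: "y \<in> weight_simplex n"
      "\<forall>B\<in>V - {A}. coalition_weight y A < coalition_weight y B"
      "\<forall>C\<in>losing n V. coalition_weight y C < coalition_weight y A"
      using ex_weights_strictly_between[OF wV U A] .
    then have "y \<in> footprint n (V - {A})"
      unfolding footprint_iff_separates[OF sU] losing by (metis insert_iff order.strict_trans)
    with y show ?thesis unfolding losing by blast
  qed
  assume ?R
  then obtain w where w: "w \<in> footprint n (V - {A})"
    "\<forall>C\<in>losing n (V - {A}). C \<noteq> A \<longrightarrow> coalition_weight w C < coalition_weight w A" by blast
  \<comment> \<open>This rules out \<open>C = A\<close> for \<open>C\<close> losing in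
    \<open>V\<close>, so the assumption on \<open>w\<close> covers every comparison with the new
    winning coalition \<open>A\<close>.\<close>
  moreover have "A \<notin> losing n V"
    using A by (simp add: losing_def)
  ultimately have "w \<in> footprint n V"
    unfolding footprint_iff_separates[OF sV] footprint_iff_separates[OF sU] losing
    by (metis Diff_iff insert_iff singletonD)
  with V show "weighted_game n V"
    by (auto simp: weighted_game_iff_footprint)
qed

theorem theorem4p17:
  fixes n :: nat
  shows
    "(\<forall>V U A. weighted_game n V \<and> linear_game n U \<and> A \<in> V \<and> U = V - {A} \<longrightarrow>
        (weighted_game n U \<longleftrightarrow>
          (\<exists>w\<in>footprint n V. \<forall>B\<in>V. B \<noteq> A \<longrightarrow> coalition_weight w A < coalition_weight w B))) \<and>
     (\<forall>U V A. weighted_game n U \<and> linear_game n V \<and> A \<in> V \<and> U = V - {A} \<longrightarrow>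
        (weighted_game n V \<longleftrightarrow>
          (\<exists>w\<in>footprint n U. \<forall>C\<in>losing n U. C \<noteq> A \<longrightarrow> coalition_weight w A > coalition_weight w C)))"
proof (intro conjI allI impI; elim conjE)
  fix V U :: "nat set set" and A
  assume "weighted_game n V" "linear_game n U" "A \<in> V" and U: "U = V - {A}"
  then show "weighted_game n U \<longleftrightarrow>
      (\<exists>w\<in>footprint n V. \<forall>B\<in>V. B \<noteq> A \<longrightarrow> coalition_weight w A < coalition_weight w B)"
    unfolding U by (intro weighted_remove_iff)
next
  fix U V :: "nat set set" and A
  assume "weighted_game n U" "linear_game n V" "A \<in> V" and U: "U = V - {A}"
  then show "weighted_game n V \<longleftrightarrow>
      (\<exists>w\<in>footprint n U. \<forall>C\<in>losing n U. C \<noteq> A \<longrightarrow>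
        coalition_weight w A > coalition_weight w C)"
    unfolding U by (intro weighted_insert_iff)
qed

end
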